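(* A matrix weighted tree is completely determined by its resistance matrix. That is, if $G$ and $G'$ are matrix weighted trees on the same vertex set $\{1,\dots,n\}$, with all edge weights positive definite matrices of order $k$, and $R(G)=R(G')$, then $G$ and $G'$ have the same edges and the same weight on each edge.
   Context: A matrix weighted graph is a finite, simple, undirected, connected graph in which each edge $ij$ is assigned a weight $W_{ij}=W_{ji}$ that is a (real symmetric) positive definite matrix of a given order $k$. A matrix weighted tree is a matrix weighted graph whose underlying graph is a tree. For a matrix weighted graph $G$ with vertices $1,\dots,n$, the Laplacian $L=L(G)$ is the $nk\times nk$ block matrix with $k\times k$ blocks $L_{ii}=\sum_{j\sim i}W_{ij}^{-1}$, $L_{ij}=-W_{ij}^{-1}$ if $i\neq j$ and $i\sim j$, and $L_{ij}=0$ if $i\ne j$ and $i\nsim j$. A $(1)$-inverse of a matrix $M$ is a matrix $C$ with $MCM=M$. The resistance matrix $R=R(G)$ is the $nk\times nk$ block matrix with blocks $R_{ij}=L^{(1)}_{ii}+L^{(1)}_{jj}-L^{(1)}_{ij}-L^{(1)}_{ji}$, where $L^{(1)}$ is any $(1)$-inverse of $L$ (the result does not depend on the choice). *)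

theory Defs
  imports
    "HOL-Analysis.Analysis"
    "Graph_Theory.Digraph_Component"
begin

text \<open>
  The vertex set is a finite type \<open>'n\<close>, the order of the weights is the cardinality of a finite
  type \<open>'k\<close>, and block matrices are indexed by \<open>'n \<times> 'k\<close>.
\<close>

definition block_matrix ::
  "('n::finite \<Rightarrow> 'n \<Rightarrow> real^'k^'k) \<Rightarrow> real^('n \<times> 'k::finite)^('n \<times> 'k)" where
  "block_matrix B = (\<chi> p q. B (fst p) (fst q) $ snd p $ snd q)"

definition block ::
  "real^('n::finite \<times> 'k::finite)^('n \<times> 'k) \<Rightarrow> 'n \<Rightarrow> 'n \<Rightarrow> real^'k^'k" where
  "block M i j = (\<chi> a b. M $ (i, a) $ (j, b))"

definition positive_definite :: "real^'k^'k \<Rightarrow> bool" where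
  "positive_definite A \<longleftrightarrow> transpose A = A \<and> (\<forall>x. x \<noteq> 0 \<longrightarrow> x \<bullet> (A *v x) > 0)"

definition one_inverse :: "real^'m^'n \<Rightarrow> real^'n^'m \<Rightarrow> bool" where
  "one_inverse M C \<longleftrightarrow> M ** C ** M = M"

text \<open>
  A simple undirected graph is a \<^locale>\<open>pair_graph\<close>: its arcs form a finite symmetric irreflexive
  relation, an edge \<open>ij\<close> being the two arcs \<open>(i, j)\<close> and \<open>(j, i)\<close>. The values of \<open>W\<close> outside the
  arcs carry no meaning.
\<close>

locale matrix_weighted_graph = pair_graph G
  for G :: "'n::finite pair_pre_digraph" +
  fixes W :: "'n \<Rightarrow> 'n \<Rightarrow> real^'k::finite^'k"
  assumes pverts_UNIV: "pverts G = UNIV"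
    and graph_connected: "Digraph_Component.connected (with_proj G)"
    and weight_sym: "\<And>i j. (i, j) \<in> parcs G \<Longrightarrow> W i j = W j i"
    and weight_posdef: "\<And>i j. (i, j) \<in> parcs G \<Longrightarrow> positive_definite (W i j)"

text \<open>
  The predicate \<^const>\<open>forest\<close> cannot be used here: for symmetric arcs, \<^const>\<open>pre_digraph.cycle\<close>
  counts \<open>u, v, u\<close> as a cycle. The cycles of an undirected simple graph are those of length at
  least 3.
\<close>

locale matrix_weighted_tree = matrix_weighted_graph G W
  for G :: "'n::finite pair_pre_digraph" and W :: "'n \<Rightarrow> 'n \<Rightarrow> real^'k::finite^'k" +
  assumes acyclic: "\<not> (\<exists>p. pre_digraph.cycle (with_proj G) p \<and> length p \<ge> 3)"

definition laplacian ::
  "'n::finite pair_pre_digraph \<Rightarrow> ('n \<Rightarrow> 'n \<Rightarrow> real^'k::finite^'k)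
    \<Rightarrow> real^('n \<times> 'k)^('n \<times> 'k)" where
  "laplacian G W = block_matrix (\<lambda>i j.
     if i = j then (\<Sum>l | (i, l) \<in> parcs G. matrix_inv (W i l))
     else if (i, j) \<in> parcs G then - matrix_inv (W i j)
     else 0)"

text \<open>
  The (1)-inverse is chosen arbitrarily; for a matrix weighted graph the result does not depend on
  the choice.
\<close>

definition resistance_matrix ::
  "'n::finite pair_pre_digraph \<Rightarrow> ('n \<Rightarrow> 'n \<Rightarrow> real^'k::finite^'k)
    \<Rightarrow> real^('n \<times> 'k)^('n \<times> 'k)" where
  "resistance_matrix G W =
     (let C = (SOME C. one_inverse (laplacian G W) C)
      in block_matrix (\<lambda>i j. block C i i + block C j j - block C i j - block C j i))"

end

theory Submission
  imports Defs
begin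

text \<open>
  Fix a root \<open>r\<close> and let \<open>P\<close> be the block matrix with blocks \<open>(\<delta>\<^sub>i\<^sub>j - \<delta>\<^sub>i\<^sub>r) I\<close>. Removing an edge
  \<open>vw\<close> of a tree splits it into two sides, and \<open>W\<^sub>v\<^sub>w\<close> times the indicator of one side is a potential
  carrying a unit current from \<open>w\<close> to \<open>v\<close>. Adding these potentials along paths from \<open>r\<close> yields \<open>K\<close>
  with \<open>L K = P\<close> whose blocks are symmetric and whose block row \<open>r\<close> vanishes. Then \<open>K\<close> is symmetric
  and equals \<open>P\<^sup>T C P\<close> for every (1)-inverse \<open>C\<close>, so \<open>2 K\<^sub>i\<^sub>j = R\<^sub>i\<^sub>r + R\<^sub>j\<^sub>r - R\<^sub>i\<^sub>j\<close> and \<open>R\<close> determines \<open>K\<close>.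
  If \<open>L\<close> and \<open>L'\<close> share the same \<open>K\<close>, then \<open>L = L P\<^sup>T = L K L' = P L' = L'\<close>.
\<close>

section \<open>Inverses and products of matrices\<close>

lemma matrix_diff_ldistrib: "A ** (B - C) = A ** B - A ** (C :: real^'p^'n)"
  by (vector matrix_matrix_mult_def sum_subtractf[symmetric] right_diff_distrib)

lemma matrix_diff_rdistrib: "(A - B) ** C = A ** C - B ** (C :: real^'p^'n)"
  by (vector matrix_matrix_mult_def sum_subtractf[symmetric] left_diff_distrib)

lemma matrix_minus_left: "(- A) ** B = - (A ** (B :: real^'p^'n))"
  by (vector matrix_matrix_mult_def sum_negf)

lemma sum_matrix_mult_left: "(\<Sum>i\<in>S. A i) ** B = (\<Sum>i\<in>S. A i ** (B :: real^'p^'n))"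
  by (induction S rule: infinite_finite_induct)
    (auto simp: matrix_matrix_mult_def vec_eq_iff distrib_right sum.distrib)

lemma matrix_inv_inverse:
  assumes "invertible A"
  shows "A ** matrix_inv A = mat 1" "matrix_inv A ** A = mat 1"
  using someI_ex[OF assms[unfolded invertible_def]] by (auto simp: matrix_inv_def)

lemma matrix_inv_inj:
  fixes A B :: "real^'k^'k"
  assumes "invertible A" "invertible B" "matrix_inv A = matrix_inv B"
  shows "A = B"
  by (metis assms matrix_inv_inverse matrix_mul_assoc matrix_mul_lid matrix_mul_rid)

lemma matrix_inv_nonzero:
  fixes A :: "real^'k^'k"
  assumes "invertible A"
  shows "matrix_inv A \<noteq> 0"
proof
  assume "matrix_inv A = 0"
  then have "mat 1 = (0 :: real^'k^'k)"
    using matrix_inv_inverse(2)[OF assms] by simp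
  then show False
    by (simp add: vec_eq_iff mat_def split: if_splits)
qed

lemma transpose_matrix_inv:
  fixes A :: "real^'k^'k"
  assumes "invertible A" "transpose A = A"
  shows "transpose (matrix_inv A) = matrix_inv A"
  by (metis assms matrix_inv_inverse matrix_mul_assoc matrix_mul_lid matrix_mul_rid
      matrix_transpose_mul transpose_mat)

lemma positive_definite_invertible:
  assumes "positive_definite A"
  shows "invertible A"
  unfolding invertible_left_inverse matrix_left_invertible_ker
  using assms by (metis inner_zero_right less_irrefl positive_definite_def)

section \<open>Block matrices\<close>

lemma block_block_matrix [simp]: "block (block_matrix B) i j = B i j"
  by (simp add: block_def block_matrix_def vec_eq_iff)

lemma block_matrix_block [simp]: "block_matrix (block M) = M"
  by (simp add: block_def block_matrix_def vec_eq_iff)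

lemma block_matrix_eq_iff: "M = N \<longleftrightarrow> (\<forall>i j. block M i j = block N i j)"
  by (metis block_matrix_block ext)

lemma block_mult: "block (M ** N) i j = (\<Sum>l\<in>UNIV. block M i l ** block N l j)"
  by (simp add: block_def matrix_matrix_mult_def vec_eq_iff sum.cartesian_product
      case_prod_beta flip: UNIV_Times_UNIV)

lemma block_transpose: "block (transpose M) i j = transpose (block M j i)"
  by (simp add: block_def transpose_def vec_eq_iff)

definition unit_block :: "'n \<Rightarrow> 'n \<Rightarrow> real^'k^'k" where
  "unit_block i j = (if i = j then mat 1 else 0)"

lemma unit_block_mult [simp]:
  "unit_block i j ** A = (if i = j then A else 0)"
  "A ** unit_block i j = (if i = j then A else 0)"
  by (auto simp: unit_block_def)

text \<open>From the left it subtracts the block column sums from block row \<open>r\<close>; from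
  the right it subtracts block column \<open>r\<close> from every block column. So it fixes from the
  left whatever has vanishing block column sums, and its transpose fixes from the left whatever has
  block row \<open>r\<close> equal to zero.\<close>

definition grounding :: "'n \<Rightarrow> real^('n::finite \<times> 'k::finite)^('n \<times> 'k)" where
  "grounding r = block_matrix (\<lambda>i j. unit_block i j - unit_block i r)"

lemma transpose_diff: "transpose (A - B) = transpose A - transpose (B :: real^'m^'n)"
  by (simp add: transpose_def vec_eq_iff)

lemma block_grounding_mult:
  "block (grounding r ** M) i j = block M i j - (if i = r then \<Sum>l\<in>UNIV. block M l j else 0)"
  by (simp add: block_mult grounding_def matrix_diff_rdistrib sum_subtractf)

lemma block_mult_grounding:
  "block (M ** grounding r) i j = block M i j - block M i r"
  by (simp add: block_mult grounding_def matrix_diff_ldistrib sum_subtractf)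

lemma block_transpose_grounding_mult:
  "block (transpose (grounding r) ** M) i j = block M i j - block M r j"
proof -
  have "transpose (grounding r) ** M = transpose (transpose M ** grounding r)"
    by (simp add: matrix_transpose_mul)
  then show ?thesis
    by (simp add: block_transpose block_mult_grounding transpose_diff)
qed

section \<open>The Laplacian\<close>

context matrix_weighted_graph
begin

lemma weight_invertible: "(i, j) \<in> parcs G \<Longrightarrow> invertible (W i j)"
  using weight_posdef positive_definite_invertible by blast

lemma transpose_inv_weight:
  "(i, j) \<in> parcs G \<Longrightarrow> transpose (matrix_inv (W i j)) = matrix_inv (W i j)"
  using weight_posdef transpose_matrix_inv weight_invertible
  by (metis positive_definite_def)

lemma not_loop [simp]: "(i, i) \<notin> parcs G"
  using no_loops' by blast

lemma block_laplacian:
  "block (laplacian G W) i j =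
     (if i = j then (\<Sum>l | (i, l) \<in> parcs G. matrix_inv (W i l))
      else if (i, j) \<in> parcs G then - matrix_inv (W i j) else 0)"
  by (simp add: laplacian_def)

text \<open>Inverse weights are nonzero, so the off-diagonal support of the Laplacian is the edge
  set.\<close>

lemma arc_iff_block_laplacian: "(i, j) \<in> parcs G \<longleftrightarrow> i \<noteq> j \<and> block (laplacian G W) i j \<noteq> 0"
  using matrix_inv_nonzero[OF weight_invertible] by (auto simp: block_laplacian)

lemma transpose_laplacian: "transpose (laplacian G W) = laplacian G W"
proof -
  have "transpose (block (laplacian G W) j i) = block (laplacian G W) i j" for i j
  proof (cases "i = j")
    case True
    have "transpose (\<Sum>l | (i, l) \<in> parcs G. matrix_inv (W i l))
        = (\<Sum>l | (i, l) \<in> parcs G. transpose (matrix_inv (W i l)))"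
      by (simp add: transpose_def vec_eq_iff)
    also have "\<dots> = (\<Sum>l | (i, l) \<in> parcs G. matrix_inv (W i l))"
      by (rule sum.cong) (auto simp: transpose_inv_weight)
    finally show ?thesis
      using True by (simp add: block_laplacian)
  next
    case False
    have "transpose (- A) = - transpose A" "transpose (0 :: real^'k^'k) = 0" for A :: "real^'k^'k"
      by (simp_all add: transpose_def vec_eq_iff)
    then show ?thesis
      using False arcs_symmetric weight_sym transpose_inv_weight
      by (auto simp: block_laplacian)
  qed
  then show ?thesis
    by (simp add: block_matrix_eq_iff block_transpose)
qed

text \<open>Read \<open>U\<close> as a matrix-valued potential: the right side is the net current
  leaving \<open>i\<close>, the edge \<open>il\<close> having conductance
  \<open>matrix_inv (W i l)\<close>.\<close>

lemma laplacian_mult_sum: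
  "(\<Sum>l\<in>UNIV. block (laplacian G W) i l ** U l)
     = (\<Sum>l | (i, l) \<in> parcs G. matrix_inv (W i l) ** (U i - U l))"
proof -
  have "(\<Sum>l\<in>UNIV. block (laplacian G W) i l ** U l)
      = block (laplacian G W) i i ** U i + (\<Sum>l\<in>UNIV - {i}. block (laplacian G W) i l ** U l)"
    by (simp add: sum.remove)
  also have "(\<Sum>l\<in>UNIV - {i}. block (laplacian G W) i l ** U l)
      = (\<Sum>l | (i, l) \<in> parcs G. - (matrix_inv (W i l) ** U l))"
    by (rule sum.mono_neutral_cong_right) (auto simp: block_laplacian matrix_minus_left)
  finally show ?thesis
    by (simp add: block_laplacian sum_matrix_mult_left matrix_diff_ldistrib sum_subtractf sum_negf)
qed

text \<open>A constant potential drives no current, so block rows sum to zero; by symmetry so do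
  block columns, and these sums are all that \<open>grounding r\<close> subtracts.\<close>

lemma grounding_mult_laplacian: "grounding r ** laplacian G W = laplacian G W"
proof -
  have row: "(\<Sum>l\<in>UNIV. block (laplacian G W) j l) = 0" for j
    using laplacian_mult_sum[of j "\<lambda>_. mat 1"] by simp
  have "(\<Sum>l\<in>UNIV. block (laplacian G W) l j) = transpose (\<Sum>l\<in>UNIV. block (laplacian G W) j l)" for j
  proof -
    have "transpose (\<Sum>l\<in>UNIV. block (laplacian G W) j l)
        = (\<Sum>l\<in>UNIV. transpose (block (laplacian G W) j l))"
      by (simp add: transpose_def vec_eq_iff)
    then show ?thesis
      by (metis (no_types, lifting) block_transpose sum.cong transpose_laplacian)
  qed
  then have "(\<Sum>l\<in>UNIV. block (laplacian G W) l j) = 0" for j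
    by (simp add: row transpose_def vec_eq_iff)
  then show ?thesis
    by (simp add: block_matrix_eq_iff block_grounding_mult)
qed

lemma laplacian_mult_transpose_grounding:
  "laplacian G W ** transpose (grounding r) = laplacian G W"
  by (metis grounding_mult_laplacian matrix_transpose_mul transpose_laplacian)

lemma rtrancl_arcs: "(u, v) \<in> (parcs G)\<^sup>*"
proof -
  have "symmetric (with_proj G)"
    using sym_arcs by simp
  then have "strongly_connected (with_proj G)"
    using graph_connected symmetric_connected_imp_strongly_connected by blast
  then have "u \<rightarrow>\<^sup>*\<^bsub>with_proj G\<^esub> v"
    by (simp add: strongly_connected_def pverts_UNIV)
  then show ?thesis
    using reachable_rtranclI by fastforce
qed

end

section \<open>Grounded potentials on a tree\<close>

context matrix_weighted_tree
begin

lemma cut_exists: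
  assumes vw: "(v, w) \<in> parcs G"
  obtains A where "w \<in> A" "v \<notin> A"
    "\<And>x y. (x, y) \<in> parcs G \<Longrightarrow> (x, y) \<noteq> (v, w) \<Longrightarrow> (x, y) \<noteq> (w, v) \<Longrightarrow> x \<in> A \<longleftrightarrow> y \<in> A"
proof -
  \<comment> \<open>Both orientations of the edge are removed, and the cut will be the part of the
    tree still reachable from \<open>w\<close>.\<close>
  define H where "H = \<lparr>pverts = (UNIV :: 'n set), parcs = parcs G - {(v, w), (w, v)}\<rparr>"
  interpret H: pair_wf_digraph H
    by unfold_locales (auto simp: H_def)
  define A where "A = {x. w \<rightarrow>\<^sup>*\<^bsub>with_proj H\<^esub> x}"
  have step: "y \<in> A" if "x \<in> A" "(x, y) \<in> parcs H" for x y
    using that H.reachable_adj_trans unfolding A_def by simp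
  have "w \<in> A"
    unfolding A_def using H.reachable_refl by (simp add: H_def)
  moreover have "v \<notin> A"
  proof
    assume "v \<in> A"
    then obtain q where q: "H.apath w q v"
      by (auto simp: A_def H.reachable_apath)
    then have verts: "distinct (pawalk_verts w q)" and cas: "pcas w q v"
      and arcs: "set q \<subseteq> parcs H"
      by (auto simp: H.apath_def H.awalk_def)
    have "v \<noteq> w"
      using vw by auto
    \<comment> \<open>A path of one arc would be the removed arc \<open>(w, v)\<close>. Closing
      \<open>q\<close> with \<open>(v, w)\<close> therefore gives a cycle of length at least 3, as
      \<open>acyclic\<close> requires.\<close>
    then have "length q \<ge> 2"
      using cas arcs by (cases q; cases "tl q") (auto simp: H_def)
    moreover have "cycle ((v, w) # q)"
      using vw verts cas arcs
      by (auto simp: cycle_def awalk_def pverts_UNIV H_def intro!: exI[of _ v])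
    ultimately show False
      using acyclic by force
  qed
  moreover have "x \<in> A \<longleftrightarrow> y \<in> A"
    if "(x, y) \<in> parcs G" "(x, y) \<noteq> (v, w)" "(x, y) \<noteq> (w, v)" for x y
  proof -
    have "(x, y) \<in> parcs H" "(y, x) \<in> parcs H"
      using that arcs_symmetric by (auto simp: H_def)
    then show ?thesis
      using step by blast
  qed
  ultimately show ?thesis
    using that by blast
qed

lemma edge_potential:
  assumes vw: "(v, w) \<in> parcs G"
  obtains U where "\<And>x. transpose (U x) = U x" "U r = 0"
    "\<And>x. (\<Sum>l | (x, l) \<in> parcs G. matrix_inv (W x l) ** (U x - U l))
       = unit_block x w - unit_block x v"
proof -
  obtain A where A: "w \<in> A" "v \<notin> A"
    "\<And>x y. (x, y) \<in> parcs G \<Longrightarrow> (x, y) \<noteq> (v, w) \<Longrightarrow> (x, y) \<noteq> (w, v) \<Longrightarrow> x \<in> A \<longleftrightarrow> y \<in> A"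
    using cut_exists[OF vw] by blast
  \<comment> \<open>Subtracting the constant \<open>indicat_real A r\<close> grounds the potential
    at \<open>r\<close> and leaves all differences unchanged.\<close>
  define c where "c x = indicat_real A x - indicat_real A r" for x
  define U where "U x = c x *\<^sub>R W v w" for x
  have wv: "(w, v) \<in> parcs G" "W w v = W v w" "v \<noteq> w"
    using vw arcs_symmetric weight_sym by auto
  \<comment> \<open>Only the edge between \<open>v\<close> and \<open>w\<close> crosses the cut, so
    at most one neighbour of \<open>x\<close> contributes: \<open>v\<close> if \<open>x\<close> is
    \<open>w\<close>, and \<open>w\<close> if \<open>x\<close> is \<open>v\<close>. At any other
    \<open>x\<close> the difference of unit blocks is zero, so naming \<open>w\<close> there is
    harmless.\<close>
  have term_eq: "matrix_inv (W x l) ** (U x - U l)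
      = (if l = (if x = w then v else w) then unit_block x w - unit_block x v else 0)"
    if xl: "(x, l) \<in> parcs G" for x l
  proof -
    have "matrix_inv (W x l) ** (U x - U l)
        = (indicat_real A x - indicat_real A l) *\<^sub>R (matrix_inv (W x l) ** W v w)"
      by (simp add: U_def c_def matrix_scalar_ac scalar_matrix_assoc flip: scaleR_diff_left)
    moreover have "matrix_inv (W v w) ** W v w = mat 1"
      using matrix_inv_inverse weight_invertible vw by blast
    ultimately show ?thesis
      using A(1,2) A(3)[OF xl] wv xl
      by (auto simp: unit_block_def indicator_def)
  qed
  have "(\<Sum>l | (x, l) \<in> parcs G. matrix_inv (W x l) ** (U x - U l))
       = unit_block x w - unit_block x v" for x
  proof -
    have "(\<Sum>l | (x, l) \<in> parcs G. matrix_inv (W x l) ** (U x - U l))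
        = (\<Sum>l | (x, l) \<in> parcs G. if l = (if x = w then v else w)
             then unit_block x w - unit_block x v else 0)"
      by (rule sum.cong) (auto simp: term_eq)
    also have "\<dots> = unit_block x w - unit_block x v"
      using vw wv by (auto simp: unit_block_def)
    finally show ?thesis .
  qed
  moreover have "transpose (U x) = U x" for x
    using weight_posdef[OF vw] by (simp add: U_def transpose_scalar positive_definite_def)
  ultimately show ?thesis
    using that[of U] by (simp add: U_def c_def)
qed

text \<open>Induction along a path from \<open>r\<close> to \<open>v\<close>: the sources and sinks
  of consecutive edge potentials telescope, while symmetry and the zero at \<open>r\<close> survive
  addition.\<close>

lemma grounded_potential:
  "\<exists>U. (\<forall>x. transpose (U x) = U x) \<and> U r = 0 \<and>
     (\<forall>x. (\<Sum>l | (x, l) \<in> parcs G. matrix_inv (W x l) ** (U x - U l))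
       = unit_block x v - unit_block x r)"
  using rtrancl_arcs[of r v]
proof (induction rule: rtrancl_induct)
  case base
  show ?case
    by (rule exI[of _ "\<lambda>_. 0"]) (simp add: transpose_def vec_eq_iff)
next
  case (step v w)
  then obtain U where U: "\<And>x. transpose (U x) = U x" "U r = 0"
    "\<And>x. (\<Sum>l | (x, l) \<in> parcs G. matrix_inv (W x l) ** (U x - U l))
       = unit_block x v - unit_block x r"
    by blast
  obtain V where V: "\<And>x. transpose (V x) = V x" "V r = 0"
    "\<And>x. (\<Sum>l | (x, l) \<in> parcs G. matrix_inv (W x l) ** (V x - V l))
       = unit_block x w - unit_block x v"
    using edge_potential[OF step.hyps(2)] by blast
  have "(\<Sum>l | (x, l) \<in> parcs G. matrix_inv (W x l) ** ((U x + V x) - (U l + V l)))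
      = unit_block x w - unit_block x r" for x
  proof -
    have "(\<Sum>l | (x, l) \<in> parcs G. matrix_inv (W x l) ** ((U x + V x) - (U l + V l)))
        = (\<Sum>l | (x, l) \<in> parcs G. matrix_inv (W x l) ** (U x - U l))
          + (\<Sum>l | (x, l) \<in> parcs G. matrix_inv (W x l) ** (V x - V l))"
      by (simp add: matrix_add_ldistrib[symmetric] algebra_simps flip: sum.distrib)
    then show ?thesis
      by (simp add: U(3) V(3))
  qed
  moreover have "transpose (U x + V x) = U x + V x" for x
  proof -
    have "transpose (U x + V x) = transpose (U x) + transpose (V x)"
      by (simp add: transpose_def vec_eq_iff)
    then show ?thesis
      by (simp add: U V)
  qed
  ultimately show ?case
    using U(2) V(2) by (intro exI[of _ "\<lambda>x. U x + V x"]) simp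
qed

lemma laplacian_grounded_inverse:
  obtains K where "laplacian G W ** K = grounding r" "transpose K = K"
    "\<And>i j. transpose (block K i j) = block K i j" "\<And>j. block K r j = 0"
proof -
  obtain U where U: "\<And>v x. transpose (U v x) = U v x" "\<And>v. U v r = 0"
    "\<And>v x. (\<Sum>l | (x, l) \<in> parcs G. matrix_inv (W x l) ** (U v x - U v l))
       = unit_block x v - unit_block x r"
  proof -
    have "\<forall>v. \<exists>U. (\<forall>x. transpose (U x) = U x) \<and> U r = 0 \<and>
      (\<forall>x. (\<Sum>l | (x, l) \<in> parcs G. matrix_inv (W x l) ** (U x - U l))
        = unit_block x v - unit_block x r)"
      using grounded_potential by blast
    from choice[OF this] show ?thesis
      using that by blast
  qed
  \<comment> \<open>Block column \<open>j\<close> is the potential of a unit current entering at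
    \<open>j\<close> and leaving at \<open>r\<close>.\<close>
  define K where "K = block_matrix (\<lambda>i j. U j i)"
  let ?L = "laplacian G W"
  have LK: "?L ** K = grounding r"
    by (simp add: block_matrix_eq_iff block_mult K_def laplacian_mult_sum U(3) grounding_def)
  \<comment> \<open>Symmetric blocks alone do not make \<open>K\<close> symmetric. Block row
    \<open>r\<close> is zero, so the transposed grounding fixes \<open>K\<close>; rewriting it as
    \<open>transpose K ** ?L\<close> gives a visibly symmetric product.\<close>
  have "K = transpose (grounding r) ** K"
    by (simp add: block_matrix_eq_iff block_transpose_grounding_mult K_def U(2))
  also have "\<dots> = transpose K ** ?L ** K"
    by (metis LK matrix_transpose_mul transpose_laplacian)
  finally have K: "K = transpose K ** ?L ** K" .
  have "transpose K = transpose (transpose K ** ?L ** K)"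
    using K by simp
  also have "\<dots> = transpose K ** ?L ** K"
    by (simp add: matrix_transpose_mul transpose_laplacian matrix_mul_assoc)
  finally have "transpose K = K"
    using K by simp
  with LK show ?thesis
    using that[of K] by (simp add: K_def U)
qed

section \<open>Recovering the grounded inverse, and then the tree, from the resistances\<close>

lemma resistance_matrix_grounded_inverse:
  obtains K where "laplacian G W ** K = grounding r" "transpose K = K"
    "\<And>i j. 2 *\<^sub>R block K i j = block (resistance_matrix G W) i r
       + block (resistance_matrix G W) j r - block (resistance_matrix G W) i j"
proof -
  let ?L = "laplacian G W"
  obtain K where K: "?L ** K = grounding r" "transpose K = K"
    "\<And>i j. transpose (block K i j) = block K i j" "\<And>j. block K r j = 0"
    using laplacian_grounded_inverse by blast
  \<comment> \<open>This witness ensures that the arbitrary choice \<open>C\<close> really is a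
    (1)-inverse.\<close>
  have "one_inverse ?L K"
    by (simp add: one_inverse_def K(1) grounding_mult_laplacian)
  define C where "C = (SOME C. one_inverse ?L C)"
  have "one_inverse ?L C"
    unfolding C_def by (rule someI) fact
  then have C: "?L ** C ** ?L = ?L"
    by (simp add: one_inverse_def)
  have KL: "K ** ?L = transpose (grounding r)"
    by (metis K(1,2) matrix_transpose_mul transpose_laplacian)
  have "K = transpose (grounding r) ** K"
    by (simp add: block_matrix_eq_iff block_transpose_grounding_mult K(4))
  also have "\<dots> = K ** (?L ** C ** ?L) ** K"
    by (simp add: C KL)
  also have "\<dots> = transpose (grounding r) ** C ** grounding r"
    by (metis K(1) KL matrix_mul_assoc)
  finally have K_eq: "block K i j
      = block C i j - block C r j - (block C i r - block C r r)" for i j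
    by (metis block_mult_grounding block_transpose_grounding_mult)
  \<comment> \<open>By \<open>K_eq\<close>, passing from \<open>C\<close> to \<open>K\<close> adds
    only terms with an index \<open>r\<close>, and these cancel in the resistance formula.\<close>
  have R: "block (resistance_matrix G W) i j
      = block K i i + block K j j - block K i j - block K j i" for i j
    by (simp add: resistance_matrix_def Let_def K_eq flip: C_def)
  \<comment> \<open>Symmetry of \<open>K\<close> swaps the indices but transposes the block;
    symmetry of each block undoes the transposition.\<close>
  have sym: "block K j i = block K i j" for i j
    using block_transpose[of K i j] by (simp add: K(2,3))
  have K_r: "block K i r = 0" for i
    using sym[of i r] K(4) by simp
  have "2 *\<^sub>R block K i j = block (resistance_matrix G W) i r
       + block (resistance_matrix G W) j r - block (resistance_matrix G W) i j" for i j
    \<comment> \<open>With block row and column \<open>r\<close> zero, the resistance between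
      \<open>i\<close> and \<open>r\<close> is the diagonal block
      \<open>block K i i\<close>.\<close>
    using sym[of i j] by (simp add: R K(4) K_r scaleR_2)
  with K(1,2) show ?thesis
    using that by blast
qed

end

theorem theorem3p9:
  fixes G G' :: "'n::finite pair_pre_digraph"
    and W W' :: "'n \<Rightarrow> 'n \<Rightarrow> real^'k::finite^'k"
  assumes "matrix_weighted_tree G W"
    and "matrix_weighted_tree G' W'"
    and "resistance_matrix G W = resistance_matrix G' W'"
  shows "parcs G = parcs G' \<and> (\<forall>(i, j) \<in> parcs G. W i j = W' i j)"
proof -
  interpret T: matrix_weighted_tree G W by fact
  interpret T': matrix_weighted_tree G' W' by fact
  fix r :: 'n
  let ?L = "laplacian G W" and ?L' = "laplacian G' W'"
  obtain K where K: "?L ** K = grounding r" "transpose K = K"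
    "\<And>i j. 2 *\<^sub>R block K i j = block (resistance_matrix G W) i r
       + block (resistance_matrix G W) j r - block (resistance_matrix G W) i j"
    using T.resistance_matrix_grounded_inverse by blast
  obtain K' where K': "?L' ** K' = grounding r" "transpose K' = K'"
    "\<And>i j. 2 *\<^sub>R block K' i j = block (resistance_matrix G W) i r
       + block (resistance_matrix G W) j r - block (resistance_matrix G W) i j"
    using T'.resistance_matrix_grounded_inverse assms(3) by metis
  have "2 *\<^sub>R block K i j = 2 *\<^sub>R block K' i j" for i j
    by (simp only: K(3) K'(3))
  then have "K = K'"
    by (simp add: block_matrix_eq_iff)
  have "?L = ?L ** transpose (grounding r)"
    by (simp add: T.laplacian_mult_transpose_grounding)
  \<comment> \<open>Transposing \<open>?L' ** K' = grounding r\<close> yields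
    \<open>K' ** ?L' = transpose (grounding r)\<close>, since both factors are symmetric.\<close>
  also have "\<dots> = ?L ** (K ** ?L')"
    by (metis K'(1,2) \<open>K = K'\<close> T'.transpose_laplacian matrix_transpose_mul)
  also have "\<dots> = ?L'"
    by (simp add: matrix_mul_assoc K(1) T'.grounding_mult_laplacian)
  finally have L: "?L = ?L'" .
  then have arcs: "parcs G = parcs G'"
    using T.arc_iff_block_laplacian T'.arc_iff_block_laplacian by auto
  moreover have "W i j = W' i j" if ij: "(i, j) \<in> parcs G" for i j
  proof -
    have "i \<noteq> j" "(i, j) \<in> parcs G'"
      using ij arcs by auto
    then have "matrix_inv (W i j) = matrix_inv (W' i j)"
      using ij L T.block_laplacian[of i j] T'.block_laplacian[of i j] by simp
    then show ?thesis
      using ij \<open>(i, j) \<in> parcs G'\<close> T.weight_invertible T'.weight_invertible matrix_inv_inj by blast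
  qed
  ultimately show ?thesis
    by blast
qed

end
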